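(* For all $x \in [0,\pi_{2,3}/2]$, $$\sin_{2,3}(2x)=\frac{4\,\sin_{2,3}(x)\,\cos_{2,3}(x)\,\bigl(3+\cos_{2,3}(x)\bigr)^3}{\bigl(1+\cos_{2,3}(x)\bigr)\bigl(8+(\sin_{2,3}(x))^3\bigr)^2}.$$
   Context: Generalized trigonometric functions. For real $p,q>1$, let $F(x):=\int_0^x \frac{dt}{(1-t^q)^{1/p}}$ for $x\in[0,1]$ and $\pi_{p,q}:=2F(1)=2\int_0^1 \frac{dt}{(1-t^q)^{1/p}}$. The function $\sin_{p,q}$ is defined on $[0,\pi_{p,q}/2]$ as the inverse function $F^{-1}$, an increasing function onto $[0,1]$. It is extended to $(\pi_{p,q}/2,\pi_{p,q}]$ by $\sin_{p,q}(x):=\sin_{p,q}(\pi_{p,q}-x)$, and then to all of $\mathbb{R}$ as the odd $2\pi_{p,q}$-periodic continuation. The resulting function is $C^1$ on $\mathbb{R}$, and $\cos_{p,q}(x):=\frac{d}{dx}\sin_{p,q}(x)$ for $x \in \mathbb{R}$. The theorem concerns the case $(p,q)=(2,3)$. *)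

theory Defs
  imports "HOL-Analysis.Analysis" "HOL-Library.Real_Mod"
begin

text \<open>
  Generalized trigonometric functions with parameters \<^term>\<open>p\<close> and \<^term>\<open>q\<close>. All definitions are
  meant for \<^prop>\<open>p > 1\<close> and \<^prop>\<open>q > 1\<close> only, where \<open>arcsin_pq p q\<close> is a strictly
  increasing bijection from \<open>[0, 1]\<close> onto \<open>[0, pi_pq p q / 2]\<close>.
\<close>

text \<open>
  The integrand is singular at \<open>t = 1\<close> (where the term below has the value 0, as division by 0
  gives 0). Since it is nonnegative, its improper integral over \<open>[0, 1]\<close> is the
  Henstock--Kurzweil integral.
\<close>

definition arcsin_pq :: "real \<Rightarrow> real \<Rightarrow> real \<Rightarrow> real" where
  "arcsin_pq p q x = integral {0..x} (\<lambda>t. 1 / (1 - t powr q) powr (1 / p))"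

definition pi_pq :: "real \<Rightarrow> real \<Rightarrow> real" where
  "pi_pq p q = 2 * arcsin_pq p q 1"

definition sin_pq_half :: "real \<Rightarrow> real \<Rightarrow> real \<Rightarrow> real" where
  "sin_pq_half p q x =
     (if x \<le> pi_pq p q / 2 then inv_into {0..1} (arcsin_pq p q) x
      else inv_into {0..1} (arcsin_pq p q) (pi_pq p q - x))"

text \<open>
  The function \<open>sin_pq_half\<close> is only meaningful on \<open>[0, pi_pq p q]\<close>. For its odd
  \<open>2 * pi_pq p q\<close>-periodic continuation, \<open>y\<close> is the representative of \<open>x\<close> modulo
  \<open>2 * pi_pq p q\<close> in \<open>[- pi_pq p q, pi_pq p q)\<close>.
\<close>

definition sin_pq :: "real \<Rightarrow> real \<Rightarrow> real \<Rightarrow> real" where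
  "sin_pq p q x =
     (let y = (x + pi_pq p q) rmod (2 * pi_pq p q) - pi_pq p q
      in if y \<ge> 0 then sin_pq_half p q y else - sin_pq_half p q (- y))"

definition cos_pq :: "real \<Rightarrow> real \<Rightarrow> real \<Rightarrow> real" where
  "cos_pq p q x = deriv (sin_pq p q) x"

end

theory Submission
  imports Defs
begin

text \<open>
  Write \<open>s = sin x\<close> and \<open>c = cos x\<close> for the generalized functions with parameters \<open>(2, 3)\<close>. On
  \<open>[0, \<pi>/2]\<close> these lie on the curve \<open>c\<^sup>2 + s\<^sup>3 = 1\<close>, and \<open>x\<close> is the elliptic integral
  \<open>F(s) = \<integral>\<^sub>0\<^sup>s dt / sqrt (1 - t\<^sup>3)\<close>. Since \<open>8 + s\<^sup>3 = 9 - c\<^sup>2 = (3 - c) (3 + c)\<close>, the right-hand side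
  of the duplication formula reduces to

  \<open>S(s) = 4 s c (3 + c) / ((1 + c) (3 - c)\<^sup>2)\<close>.

  The formula holds because \<open>(S, P/Q)\<close>, with \<open>P = c\<^sup>4 + 24 c\<^sup>3 + 18 c\<^sup>2 - 27\<close> and
  \<open>Q = (1 + c) (3 - c)\<^sup>3\<close>, is the double of the point \<open>(s, c)\<close> on that curve, whose neutral
  element is the flex \<open>(0, 1)\<close>. The proof rests on two rational identities in \<open>c\<close>: the new point lies on the curve,
  \<open>1 - S\<^sup>3 = (P/Q)\<^sup>2\<close> (lemma \<open>dup_curve\<close>), and \<open>dS/ds = 2 P / (Q c)\<close> (lemma \<open>DERIV_dup\<close>). Together they
  show that \<open>F \<circ> S\<close> has derivative \<open>(dS/ds) / sqrt (1 - S\<^sup>3) = \<plusminus> 2 / c\<close>, which is \<open>\<plusminus> 2\<close> times the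
  derivative of \<open>F\<close>; the sign is that of \<open>P\<close>. As \<open>P\<close> increases with \<open>c\<close>, hence decreases with \<open>s\<close>,
  its sign changes once, at \<open>x = \<pi>/4\<close>. Where \<open>P \<ge> 0\<close>, comparing values at \<open>s = 0\<close> gives
  \<open>F(S(s)) = 2 F(s)\<close>; where \<open>P \<le> 0\<close>, comparing values at \<open>s = 1\<close> gives \<open>F(S(s)) = \<pi> - 2 F(s)\<close>. In both
  cases the sine of \<open>2 x = 2 F(s)\<close> is \<open>S(s)\<close>, because the sine is symmetric about \<open>\<pi>/2\<close>.

  For arbitrary \<open>p, q > 1\<close>, the preliminary part shows that \<open>F\<close> is an increasing bijection and that
  \<open>cos (F s) = (1 - s\<^sup>q)\<^sup>1\<^sup>/\<^sup>p\<close> for \<open>0 < s \<le> 1\<close>. The delicate point is \<open>s = 1\<close>: the cosine is a two-sided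
  derivative, and there \<open>F\<close> has infinite slope, so the inverse function rule does not apply.
\<close>

section \<open>The integral defining the inverse sine\<close>

text \<open>
  The singularity at \<open>t = 1\<close> is integrable because \<open>t\<^sup>q \<le> t\<close> on \<open>[0, 1]\<close>: the integrand is dominated by
  \<open>(1 - t)\<close> to the power \<open>- 1 / p\<close>, and \<open>1 / p < 1\<close>.
\<close>

lemma arcsin_pq_integrable:
  assumes p: "1 < p" and q: "1 < q"
  shows "(\<lambda>t::real. 1 / (1 - t powr q) powr (1 / p)) integrable_on {0..1}"
proof -
  define e where "e = 1 - 1 / p"
  have e: "e > 0" using p by (simp add: e_def field_simps)
  have "((\<lambda>t. (1 - t) powr (- 1 / p)) has_integral
          (- ((1 - 1) powr e / e) - - ((1 - 0) powr e / e))) {0..1::real}"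
  proof (rule fundamental_theorem_of_calculus_interior)
    show "continuous_on {0..1} (\<lambda>t::real. - ((1 - t) powr e / e))"
      using e by (intro continuous_intros continuous_on_powr') auto
    fix t :: real assume t: "t \<in> {0<..<1}"
    have "((\<lambda>t. - ((1 - t) powr e / e)) has_real_derivative (1 - t) powr (- 1 / p)) (at t)"
      using t e by (auto intro!: derivative_eq_intros simp: e_def)
    then show "((\<lambda>t. - ((1 - t) powr e / e)) has_vector_derivative (1 - t) powr (- 1 / p)) (at t)"
      by (simp add: has_real_derivative_iff_has_vector_derivative)
  qed auto
  then have dom: "(\<lambda>t. (1 - t) powr (- 1 / p)) integrable_on {0..1::real}"
    by blast
  show ?thesis
  proof (rule measurable_bounded_by_integrable_imp_integrable_real[OF _ dom])
    have "(\<lambda>t::real. 1 / (1 - t powr q) powr (1 / p)) \<in> borel_measurable borel"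
      by measurable
    then show "(\<lambda>t::real. 1 / (1 - t powr q) powr (1 / p)) \<in> borel_measurable (lebesgue_on {0..1})"
      by (simp add: borel_measurable_if_D measurable_completion measurable_restrict_space1)
    fix t :: real assume t: "t \<in> {0..1}"
    show "\<bar>1 / (1 - t powr q) powr (1 / p)\<bar> \<le> (1 - t) powr (- 1 / p)"
    proof (cases "t = 1")
      case False
      have "t powr q \<le> t powr 1"
        using t q by (intro powr_mono') auto
      then have "(1 - t) powr (1 / p) \<le> (1 - t powr q) powr (1 / p)"
        using t p by (intro powr_mono2) auto
      then show ?thesis
        using t False by (simp add: powr_minus_divide frac_le)
    qed auto
  qed auto
qed

lemma continuous_on_arcsin_pq:
  assumes "1 < p" "1 < q"
  shows "continuous_on {0..1} (arcsin_pq p q)"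
  unfolding arcsin_pq_def[abs_def]
  by (rule indefinite_integral_continuous_1[OF arcsin_pq_integrable[OF assms]])

lemma DERIV_arcsin_pq:
  assumes p: "1 < p" and q: "1 < q" and s: "0 < s" "s < 1"
  shows "DERIV (arcsin_pq p q) s :> 1 / (1 - s powr q) powr (1 / p)"
proof -
  (* On [0, b] the integrand is continuous, and s is an interior point. *)
  define b where "b = (1 + s) / 2"
  have b: "s < b" "b < 1" using s by (auto simp: b_def)
  have *: "t powr q < 1" if "0 \<le> t" "t \<le> b" for t
    using that b q powr_less_mono2[of q t 1] by auto
  have "continuous_on {0..b} (\<lambda>t::real. 1 / (1 - t powr q) powr (1 / p))"
    using p q by (intro continuous_on_divide continuous_on_const continuous_on_powr' continuous_on_diff
        continuous_on_id) (auto dest: * simp: less_imp_le[OF *] less_imp_neq[OF *])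
  then have "(arcsin_pq p q has_real_derivative 1 / (1 - s powr q) powr (1 / p)) (at s within {0..b})"
    unfolding arcsin_pq_def[abs_def]
    using s b by (intro integral_has_real_derivative) auto
  moreover have "at s within {0..b} = at s"
    using s b by (intro at_within_interior) auto
  ultimately show ?thesis by simp
qed

lemma arcsin_pq_0 [simp]: "arcsin_pq p q 0 = 0"
  by (simp add: arcsin_pq_def)

lemma arcsin_pq_strict_mono:
  assumes p: "1 < p" and q: "1 < q" and "0 \<le> s" "s < t" "t \<le> 1"
  shows "arcsin_pq p q s < arcsin_pq p q t"
proof (rule DERIV_pos_imp_increasing_open[OF \<open>s < t\<close>])
  show "continuous_on {s..t} (arcsin_pq p q)"
    using assms by (intro continuous_on_subset[OF continuous_on_arcsin_pq]) auto
  fix u assume u: "s < u" "u < t"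
  then have "u powr q < 1"
    using assms powr_less_mono2[of q u 1] by auto
  then show "\<exists>y. DERIV (arcsin_pq p q) u :> y \<and> y > 0"
    using DERIV_arcsin_pq[of p q u] assms u by (intro exI conjI) auto
qed

lemma bij_betw_arcsin_pq:
  assumes p: "1 < p" and q: "1 < q"
  shows "bij_betw (arcsin_pq p q) {0..1} {0..pi_pq p q / 2}"
proof -
  have inj: "inj_on (arcsin_pq p q) {0..1}"
    using arcsin_pq_strict_mono[OF p q]
    by (intro linorder_inj_onI') (auto simp: less_le)
  have mono: "arcsin_pq p q s \<le> arcsin_pq p q t" if "0 \<le> s" "s \<le> t" "t \<le> 1" for s t
    using arcsin_pq_strict_mono[OF p q, of s t] that by (cases "s = t") auto
  have "\<exists>s\<ge>0. s \<le> 1 \<and> arcsin_pq p q s = x" if "0 \<le> x" "x \<le> pi_pq p q / 2" for x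
    using that continuous_on_arcsin_pq[OF p q] by (intro IVT') (auto simp: pi_pq_def)
  then have "arcsin_pq p q ` {0..1} = {0..pi_pq p q / 2}"
    using mono[of 0] mono[of _ 1] by (fastforce simp: pi_pq_def)
  with inj show ?thesis by (simp add: bij_betw_def)
qed

lemma arcsin_pq_exhaust:
  assumes "1 < p" "1 < q" "x \<in> {0..pi_pq p q / 2}"
  obtains s where "s \<in> {0..1}" "x = arcsin_pq p q s"
  using bij_betw_imp_surj_on[OF bij_betw_arcsin_pq[OF assms(1,2)]] assms(3) by blast

lemma pi_pq_pos:
  assumes "1 < p" "1 < q"
  shows "pi_pq p q > 0"
  using arcsin_pq_strict_mono[OF assms, of 0 1] by (simp add: pi_pq_def)

section \<open>The generalized sine on one half-period\<close>

lemma sin_pq_eq_half: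
  assumes "0 \<le> x" "x < pi_pq p q"
  shows "sin_pq p q x = sin_pq_half p q x"
  using assms by (simp add: sin_pq_def)

lemma sin_pq_arcsin_pq:
  assumes p: "1 < p" and q: "1 < q" and s: "s \<in> {0..1}"
  shows "sin_pq p q (arcsin_pq p q s) = s"
proof -
  have "arcsin_pq p q s \<in> {0..pi_pq p q / 2}"
    using bij_betw_apply[OF bij_betw_arcsin_pq[OF p q] s] .
  moreover have "inv_into {0..1} (arcsin_pq p q) (arcsin_pq p q s) = s"
    using bij_betw_inv_into_left[OF bij_betw_arcsin_pq[OF p q] s] .
  ultimately show ?thesis
    using pi_pq_pos[OF p q] by (subst sin_pq_eq_half) (auto simp: sin_pq_half_def)
qed

text \<open>
  At \<open>s = 0\<close> the argument is \<open>\<pi>\<close> itself, whose representative modulo \<open>2 \<pi>\<close> in the definition of the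
  sine is \<open>- \<pi>\<close>; the value there comes from the odd continuation and is treated separately.
\<close>

lemma sin_pq_reflect:
  assumes p: "1 < p" and q: "1 < q" and s: "s \<in> {0..1}"
  shows "sin_pq p q (pi_pq p q - arcsin_pq p q s) = s"
proof -
  note bij = bij_betw_arcsin_pq[OF p q]
  have F: "arcsin_pq p q s \<in> {0..pi_pq p q / 2}"
    using bij_betw_apply[OF bij s] .
  have inv: "inv_into {0..1} (arcsin_pq p q) (arcsin_pq p q s) = s" if "s \<in> {0..1}" for s
    using bij_betw_inv_into_left[OF bij that] .
  show ?thesis
  proof (cases "s = 0")
    case True
    then show ?thesis
      using pi_pq_pos[OF p q] inv[of 0] by (simp add: sin_pq_def sin_pq_half_def)
  next
    case False
    then have "arcsin_pq p q s > 0"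
      using arcsin_pq_strict_mono[OF p q, of 0 s] s by auto
    then have "sin_pq p q (pi_pq p q - arcsin_pq p q s) = sin_pq_half p q (pi_pq p q - arcsin_pq p q s)"
      using F by (intro sin_pq_eq_half) auto
    also have "\<dots> = s"
    proof (cases "arcsin_pq p q s = pi_pq p q / 2")
      case True
      then have "pi_pq p q - arcsin_pq p q s = arcsin_pq p q s" by simp
      then show ?thesis
        using F inv[OF s] by (simp only: sin_pq_half_def) simp
    qed (use F inv[OF s] in \<open>auto simp: sin_pq_half_def\<close>)
    finally show ?thesis .
  qed
qed

lemma sin_pq_pi_minus:
  assumes "1 < p" "1 < q" "x \<in> {0..pi_pq p q}"
  shows "sin_pq p q (pi_pq p q - x) = sin_pq p q x"
proof -
  have img: "\<exists>s\<in>{0..1}. y = arcsin_pq p q s" if "y \<in> {0..pi_pq p q / 2}" for y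
    using arcsin_pq_exhaust[OF assms(1,2) that] by blast
  show ?thesis
  proof (cases "x \<le> pi_pq p q / 2")
    case True
    then show ?thesis using img[of x] assms sin_pq_reflect sin_pq_arcsin_pq by auto
  next
    case False
    then obtain s where s: "s \<in> {0..1}" "pi_pq p q - x = arcsin_pq p q s"
      using img[of "pi_pq p q - x"] assms by auto
    then have "x = pi_pq p q - arcsin_pq p q s" by simp
    then show ?thesis
      using sin_pq_reflect[OF assms(1,2) s(1)] sin_pq_arcsin_pq[OF assms(1,2) s(1)] s(2) by metis
  qed
qed

lemma continuous_on_sin_pq:
  assumes p: "1 < p" and q: "1 < q"
  shows "continuous_on {0..pi_pq p q} (sin_pq p q)"
proof -
  have left: "continuous_on {0..pi_pq p q / 2} (sin_pq p q)"
    using continuous_on_inv[OF continuous_on_arcsin_pq[OF p q], of "sin_pq p q"]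
      sin_pq_arcsin_pq[OF p q] bij_betw_imp_surj_on[OF bij_betw_arcsin_pq[OF p q]]
    by auto
  have "continuous_on {pi_pq p q / 2..pi_pq p q} (\<lambda>x. sin_pq p q (pi_pq p q - x))"
    by (intro continuous_on_compose2[OF left] continuous_intros) auto
  then have right: "continuous_on {pi_pq p q / 2..pi_pq p q} (sin_pq p q)"
    using pi_pq_pos[OF p q]
    by (subst (asm) continuous_on_cong[OF refl sin_pq_pi_minus[OF p q]]) auto
  have "{0..pi_pq p q} = {0..pi_pq p q / 2} \<union> {pi_pq p q / 2..pi_pq p q}"
    using pi_pq_pos[OF p q] by auto
  with left right show ?thesis
    by (simp add: continuous_on_closed_Un)
qed

lemma isCont_sin_pq:
  assumes "1 < p" "1 < q" "0 < x" "x < pi_pq p q"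
  shows "isCont (sin_pq p q) x"
  using continuous_on_interior[OF continuous_on_sin_pq[OF assms(1,2)]] assms(3,4) by simp

section \<open>The generalized cosine\<close>

lemma DERIV_sin_pq_interior:
  assumes p: "1 < p" and q: "1 < q" and s: "0 < s" "s < 1"
  shows "DERIV (sin_pq p q) (arcsin_pq p q s) :> (1 - s powr q) powr (1 / p)"
proof -
  let ?x = "arcsin_pq p q s"
  have x: "0 < ?x" "?x < pi_pq p q / 2"
    using arcsin_pq_strict_mono[OF p q, of 0 s] arcsin_pq_strict_mono[OF p q, of s 1] s
    by (auto simp: pi_pq_def)
  have "s powr q < 1" using s q powr_less_mono2[of q s 1] by auto
  moreover have "arcsin_pq p q (sin_pq p q y) = y" if "0 < y" "y < pi_pq p q / 2" for y
    using arcsin_pq_exhaust[OF p q, of y] sin_pq_arcsin_pq[OF p q] that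
    by (metis atLeastAtMost_iff less_imp_le)
  ultimately have "DERIV (sin_pq p q) ?x :> inverse (1 / (1 - s powr q) powr (1 / p))"
    using x s DERIV_arcsin_pq[OF p q s] isCont_sin_pq[OF p q, of ?x] sin_pq_arcsin_pq[OF p q, of s]
    by (intro DERIV_inverse_function[where f = "arcsin_pq p q" and a = 0 and b = "pi_pq p q / 2"])
       auto
  then show ?thesis by simp
qed

text \<open>
  By the mean value theorem, \<open>F(1) - F(s)\<close> is \<open>1 - s\<close> times a value of the integrand on \<open>(s, 1)\<close>, and
  the integrand is increasing. In terms of the sine this bounds its difference quotient at \<open>\<pi>/2\<close> by a
  quantity that vanishes as \<open>s\<close> tends to 1.
\<close>

lemma one_minus_sin_pq_le:
  assumes p: "1 < p" and q: "1 < q" and s: "0 \<le> s" "s \<le> 1"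
  shows "1 - s \<le> (1 - s powr q) powr (1 / p) * (pi_pq p q / 2 - arcsin_pq p q s)"
proof (cases "s = 1")
  case False
  then have "s < 1" using s by simp
  have "continuous_on {s..1} (arcsin_pq p q)"
    using s by (intro continuous_on_subset[OF continuous_on_arcsin_pq[OF p q]]) auto
  moreover have "arcsin_pq p q differentiable (at t)" if "s < t" "t < 1" for t
    using DERIV_arcsin_pq[OF p q, of t] that s real_differentiable_def by auto
  ultimately obtain l t where t: "s < t" "t < 1" "DERIV (arcsin_pq p q) t :> l"
      "arcsin_pq p q 1 - arcsin_pq p q s = (1 - s) * l"
    using MVT[OF \<open>s < 1\<close>, of "arcsin_pq p q"] by blast
  have l: "l = 1 / (1 - t powr q) powr (1 / p)"
    using DERIV_unique[OF t(3) DERIV_arcsin_pq[OF p q]] t s by auto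
  have "s powr q \<le> t powr q" "t powr q < 1"
    using t s q powr_less_mono2[of q t 1] by (auto intro: powr_mono2)
  then have "(1 - t powr q) powr (1 / p) \<le> (1 - s powr q) powr (1 / p)" "(1 - t powr q) powr (1 / p) > 0"
    using p by (auto intro: powr_mono2)
  then have "1 \<le> (1 - s powr q) powr (1 / p) * l"
    by (simp add: l field_simps)
  then have "(1 - s) * 1 \<le> (1 - s) * ((1 - s powr q) powr (1 / p) * l)"
    using s by (intro mult_left_mono) auto
  then show ?thesis
    using t(4) by (simp add: pi_pq_def mult_ac)
qed (simp add: pi_pq_def)

text \<open>
  The symmetry about \<open>\<pi>/2\<close> carries the preceding bound over to the right-hand side of the peak, so the
  difference quotient is squeezed to 0 from both sides.
\<close>

lemma DERIV_sin_pq_half_pi: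
  assumes p: "1 < p" and q: "1 < q"
  shows "DERIV (sin_pq p q) (pi_pq p q / 2) :> 0"
proof -
  let ?h = "pi_pq p q / 2" and ?S = "sin_pq p q"
  note pos = pi_pq_pos[OF p q]
  have S1: "?S ?h = 1"
    using sin_pq_arcsin_pq[OF p q, of 1] by (simp add: pi_pq_def)
  have left: "?S y \<in> {0..1} \<and> 1 - ?S y \<le> (1 - ?S y powr q) powr (1 / p) * \<bar>y - ?h\<bar>"
    if y: "y \<in> {0..?h}" for y
  proof -
    obtain s where s: "s \<in> {0..1}" "y = arcsin_pq p q s"
      using arcsin_pq_exhaust[OF p q y] by blast
    then show ?thesis
      using one_minus_sin_pq_le[OF p q, of s] sin_pq_arcsin_pq[OF p q s(1)] y by auto
  qed
  have near: "?S y \<in> {0..1} \<and> 1 - ?S y \<le> (1 - ?S y powr q) powr (1 / p) * \<bar>y - ?h\<bar>"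
    if y: "0 < y" "y < pi_pq p q" for y
  proof (cases "y \<le> ?h")
    case False
    have "\<bar>pi_pq p q - y - ?h\<bar> = \<bar>y - ?h\<bar>" by (simp add: abs_if)
    then show ?thesis
      using left[of "pi_pq p q - y"] sin_pq_pi_minus[OF p q, of y] y False by auto
  qed (use left[of y] y in auto)
  have ev: "eventually (\<lambda>y. y \<in> {0<..<pi_pq p q}) (at ?h)"
    using pos by (intro eventually_at_in_open') auto
  have "(?S \<longlongrightarrow> 1) (at ?h)"
    using isCont_sin_pq[OF p q, of ?h] pos S1 by (simp add: isCont_def)
  moreover have "eventually (\<lambda>y. 0 \<le> 1 - ?S y powr q) (at ?h)"
    using ev by eventually_elim (use near q in \<open>auto intro!: powr_le1\<close>)
  ultimately have "((\<lambda>y. (1 - ?S y powr q) powr (1 / p)) \<longlongrightarrow> (1 - 1 powr q) powr (1 / p)) (at ?h)"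
    using p q by (intro tendsto_powr' tendsto_diff tendsto_const) auto
  then have lim: "((\<lambda>y. (1 - ?S y powr q) powr (1 / p)) \<longlongrightarrow> 0) (at ?h)" by simp
  have "eventually (\<lambda>y. norm ((?S y - ?S ?h) / (y - ?h)) \<le> (1 - ?S y powr q) powr (1 / p)) (at ?h)"
    using ev eventually_neq_at_within[of ?h]
  proof eventually_elim
    case (elim y)
    then show ?case
      using near[of y] by (simp add: S1 abs_divide divide_le_eq)
  qed
  then have "((\<lambda>y. (?S y - ?S ?h) / (y - ?h)) \<longlongrightarrow> 0) (at ?h)"
    by (rule Lim_null_comparison[OF _ lim])
  then show ?thesis by (simp add: has_field_derivative_iff)
qed

lemma cos_pq_arcsin_pq:
  assumes p: "1 < p" and q: "1 < q" and s: "0 < s" "s \<le> 1"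
  shows "cos_pq p q (arcsin_pq p q s) = (1 - s powr q) powr (1 / p)"
proof (cases "s = 1")
  case True
  then show ?thesis
    using DERIV_imp_deriv[OF DERIV_sin_pq_half_pi[OF p q]] by (simp add: cos_pq_def pi_pq_def)
next
  case False
  then show ?thesis
    using DERIV_imp_deriv[OF DERIV_sin_pq_interior[OF p q, of s]] s by (simp add: cos_pq_def)
qed

section \<open>The duplication map for \<open>(p, q) = (2, 3)\<close>\<close>

text \<open>
  Where \<open>x\<close> lies in \<open>[0, \<pi>/2]\<close> and \<open>c\<close> is its cosine, the sine of \<open>2 x\<close> is \<open>dup_coeff c\<close> times that of \<open>x\<close>, and the cosine
  of \<open>2 x\<close> is \<open>dup_num c / dup_den c\<close>.
\<close>

definition dup_coeff :: "real \<Rightarrow> real" where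
  "dup_coeff c = 4 * c * (3 + c) / ((1 + c) * (3 - c) ^ 2)"

definition dup_num :: "real \<Rightarrow> real" where
  "dup_num c = c ^ 4 + 24 * c ^ 3 + 18 * c ^ 2 - 27"

definition dup_den :: "real \<Rightarrow> real" where
  "dup_den c = (1 + c) * (3 - c) ^ 3"

lemma dup_den_pos: "0 \<le> c \<Longrightarrow> c \<le> 1 \<Longrightarrow> dup_den c > 0"
  by (simp add: dup_den_def)

text \<open>
  Doubling maps the curve to itself. With \<open>Q = dup_den c\<close>, the numerator
  \<open>Q\<^sup>2 - 64 c\<^sup>3 (1 - c) (3 + c)\<^sup>3\<close> is a perfect square because \<open>(1 - c) (3 + c)\<^sup>3 = Q - 16 c\<^sup>3\<close>, so that
  it equals \<open>(Q - 32 c\<^sup>3)\<^sup>2\<close>, and \<open>32 c\<^sup>3 - Q = dup_num c\<close>.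
\<close>

lemma dup_curve:
  assumes c: "0 \<le> c" "c \<le> 1" and sc: "s ^ 3 = 1 - c ^ 2"
  shows "1 - (s * dup_coeff c) ^ 3 = (dup_num c / dup_den c) ^ 2"
proof -
  have "1 - (s * dup_coeff c) ^ 3 = 1 - (1 - c ^ 2) * dup_coeff c ^ 3"
    by (simp add: power_mult_distrib sc)
  also have "(1 - c ^ 2) * dup_coeff c ^ 3
      = (1 - c) * (1 + c) * (4 * c * (3 + c)) ^ 3 / ((1 + c) ^ 3 * (3 - c) ^ 6)"
  proof -
    have "1 - c ^ 2 = (1 - c) * (1 + c)" by algebra
    then show ?thesis
      by (simp only: dup_coeff_def power_divide power_mult_distrib power_mult[symmetric]) simp
  qed
  also have "\<dots> = (1 - c) * (4 * c * (3 + c)) ^ 3 / ((1 + c) ^ 2 * (3 - c) ^ 6)"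
    using c by (simp add: divide_simps power2_eq_square power3_eq_cube)
  also have "1 - \<dots> = ((1 + c) ^ 2 * (3 - c) ^ 6 - (1 - c) * (4 * c * (3 + c)) ^ 3)
      / ((1 + c) ^ 2 * (3 - c) ^ 6)"
    using c by (simp add: diff_divide_distrib)
  also have "(1 + c) ^ 2 * (3 - c) ^ 6 - (1 - c) * (4 * c * (3 + c)) ^ 3 = dup_num c ^ 2"
    unfolding dup_num_def by algebra
  also have "(1 + c) ^ 2 * (3 - c) ^ 6 = dup_den c ^ 2"
    unfolding dup_den_def by algebra
  finally show ?thesis by (simp add: power_divide)
qed

lemma dup_num_strict_mono:
  assumes "0 \<le> c" "c < d"
  shows "dup_num c < dup_num d"
  using assms power_strict_mono[of c d 4] power_strict_mono[of c d 3] power_strict_mono[of c d 2]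
  by (simp add: dup_num_def)

text \<open>
  The doubling of the sine as a function of \<open>s\<close> alone, on the branch \<open>c \<ge> 0\<close> of the curve.
\<close>

definition dup :: "real \<Rightarrow> real" where
  "dup s = s * dup_coeff (sqrt (1 - s ^ 3))"

lemma sqrt_one_minus_cube:
  assumes "0 \<le> (s::real)" "s \<le> 1"
  shows "0 \<le> sqrt (1 - s ^ 3)" "sqrt (1 - s ^ 3) \<le> 1" "s ^ 3 = 1 - sqrt (1 - s ^ 3) ^ 2"
  using assms by (auto simp: power_le_one)

lemma dup_cube:
  assumes "0 \<le> s" "s \<le> 1"
  shows "1 - dup s ^ 3 = (dup_num (sqrt (1 - s ^ 3)) / dup_den (sqrt (1 - s ^ 3))) ^ 2"
  unfolding dup_def by (rule dup_curve[OF sqrt_one_minus_cube[OF assms]])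

lemma dup_in_unit:
  assumes "0 \<le> s" "s \<le> 1"
  shows "dup s \<in> {0..1}"
proof -
  have "0 \<le> dup s"
    unfolding dup_def dup_coeff_def using assms sqrt_one_minus_cube(1,2)[OF assms] by simp
  moreover have "0 \<le> 1 - dup s ^ 3"
    unfolding dup_cube[OF assms] by simp
  ultimately show ?thesis
    using power_mono_iff[of "dup s" 1 3] by simp
qed

lemma continuous_on_dup: "continuous_on {0..1} dup"
proof -
  have "1 + sqrt (1 - s ^ 3) \<noteq> 0" "3 - sqrt (1 - s ^ 3) \<noteq> 0" if "s \<in> {0..1}" for s :: real
    using sqrt_one_minus_cube(1,2)[of s] that unfolding atLeastAtMost_iff by linarith+
  then show ?thesis
    unfolding dup_def dup_coeff_def by (intro continuous_intros) auto
qed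

lemma DERIV_dup_coeff:
  assumes "0 \<le> c" "c \<le> 1"
  shows "DERIV dup_coeff c :> 4 * (9 + 9 * c + 9 * c ^ 2 + c ^ 3) / ((1 + c) ^ 2 * (3 - c) ^ 3)"
proof -
  have nz: "1 + c \<noteq> 0" "3 - c \<noteq> 0" using assms by auto
  have "DERIV dup_coeff c :>
      (4 * (3 + 2 * c) * ((1 + c) * (3 - c) ^ 2) - 4 * c * (3 + c) * ((3 - c) ^ 2 - 2 * (1 + c) * (3 - c)))
      / ((1 + c) * (3 - c) ^ 2) ^ 2"
  proof -
    have "DERIV (\<lambda>c. 4 * c * (3 + c)) c :> 4 * (3 + 2 * c)"
      by (auto intro!: derivative_eq_intros)
    moreover have "DERIV (\<lambda>c. (1 + c) * (3 - c) ^ 2) c :> (3 - c) ^ 2 - 2 * (1 + c) * (3 - c)"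
      by (auto intro!: derivative_eq_intros simp: algebra_simps)
    ultimately show ?thesis
      unfolding dup_coeff_def[abs_def] power2_eq_square[of "(1 + c) * (3 - c) ^ 2"]
      using nz by (intro DERIV_divide) auto
  qed
  also have "(4 * (3 + 2 * c) * ((1 + c) * (3 - c) ^ 2) - 4 * c * (3 + c) * ((3 - c) ^ 2 - 2 * (1 + c) * (3 - c)))
      = (3 - c) * (4 * (9 + 9 * c + 9 * c ^ 2 + c ^ 3))"
    by algebra
  also have "((1 + c) * (3 - c) ^ 2) ^ 2 = (3 - c) * ((1 + c) ^ 2 * (3 - c) ^ 3)"
    by algebra
  finally show ?thesis using nz by simp
qed

text \<open>
  The curve \<open>c\<^sup>2 = 1 - s\<^sup>3\<close> gives \<open>dc/ds = - 3 s\<^sup>2 / (2 c)\<close>; the product rule then produces \<open>s\<^sup>3\<close>, which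
  is replaced by \<open>(1 - c) (1 + c)\<close> so that everything becomes rational in \<open>c\<close>. The factor \<open>dup_num c\<close> in
  the result is what cancels against the square root of \<open>1 - dup s ^ 3\<close>.
\<close>

lemma DERIV_dup:
  assumes s: "0 < s" "s < 1"
  defines "c \<equiv> sqrt (1 - s ^ 3)"
  shows "DERIV dup s :> 2 * dup_num c / (dup_den c * c)"
proof -
  have s3: "s ^ 3 < 1" using s by (simp add: power_less_one_iff)
  have c: "0 < c" "c \<le> 1" "s ^ 3 = 1 - c ^ 2"
    using sqrt_one_minus_cube[of s] s s3 by (auto simp: c_def)
  let ?N = "9 + 9 * c + 9 * c ^ 2 + c ^ 3"
  have dc: "DERIV (\<lambda>s. sqrt (1 - s ^ 3)) s :> - 3 * s ^ 2 / (2 * c)"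
    using s3 by (auto intro!: derivative_eq_intros simp: c_def field_simps)
  have "DERIV dup s :> 1 * dup_coeff c
      + 4 * ?N / ((1 + c) ^ 2 * (3 - c) ^ 3) * (- 3 * s ^ 2 / (2 * c)) * s"
    unfolding dup_def[abs_def]
    using DERIV_mult[OF DERIV_ident DERIV_chain2[OF DERIV_dup_coeff dc]] c(1,2)
    by (simp add: c_def)
  also have "1 * dup_coeff c + 4 * ?N / ((1 + c) ^ 2 * (3 - c) ^ 3) * (- 3 * s ^ 2 / (2 * c)) * s
      = dup_coeff c - 6 * ?N * s ^ 3 / ((1 + c) ^ 2 * (3 - c) ^ 3 * c)"
  proof -
    have "4 * N / X * (- 3 * s ^ 2 / (2 * c)) * s = - (6 * N * s ^ 3 / (X * c))" for N X
      by (simp add: power2_eq_square power3_eq_cube)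
    then show ?thesis by (simp only: mult_1 diff_conv_add_uminus)
  qed
  also have "\<dots> = (4 * c ^ 2 * (3 + c) * (3 - c) - 6 * (1 - c) * ?N) / ((1 + c) * (3 - c) ^ 3 * c)"
  proof -
    have "6 * ?N * s ^ 3 / ((1 + c) ^ 2 * (3 - c) ^ 3 * c)
        = ((1 + c) * (6 * (1 - c) * ?N)) / ((1 + c) * ((1 + c) * (3 - c) ^ 3 * c))"
      unfolding c(3) by (intro arg_cong2[where f = "(/)"]; algebra)
    also have "\<dots> = 6 * (1 - c) * ?N / ((1 + c) * (3 - c) ^ 3 * c)"
      using c by (subst mult_divide_mult_cancel_left) auto
    finally have 1: "6 * ?N * s ^ 3 / ((1 + c) ^ 2 * (3 - c) ^ 3 * c) = \<dots>" .
    have "dup_coeff c = ((c * (3 - c)) * (4 * c * (3 + c))) / ((c * (3 - c)) * ((1 + c) * (3 - c) ^ 2))"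
      unfolding dup_coeff_def using c by (subst mult_divide_mult_cancel_left) auto
    also have "\<dots> = 4 * c ^ 2 * (3 + c) * (3 - c) / ((1 + c) * (3 - c) ^ 3 * c)"
      by (intro arg_cong2[where f = "(/)"]; algebra)
    finally have 2: "dup_coeff c = \<dots>" .
    show ?thesis unfolding 1 2 by (simp only: diff_divide_distrib)
  qed
  also have "4 * c ^ 2 * (3 + c) * (3 - c) - 6 * (1 - c) * ?N = 2 * dup_num c"
    unfolding dup_num_def by algebra
  finally show ?thesis by (simp add: dup_den_def)
qed

section \<open>Doubling the argument of the inverse sine\<close>

abbreviation arcsin_23 :: "real \<Rightarrow> real" where
  "arcsin_23 \<equiv> arcsin_pq 2 3"

lemma DERIV_arcsin_23:
  assumes "0 < s" "s < 1"
  shows "DERIV arcsin_23 s :> 1 / sqrt (1 - s ^ 3)"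
  using DERIV_arcsin_pq[of 2 3 s] assms power_le_one[of s 3] by (simp add: powr_half_sqrt)

text \<open>
  The differential \<open>ds / c\<close> is doubled by the duplication map, up to the sign lost in taking the
  positive square root of \<open>1 - dup s ^ 3\<close>. The derivative is unavailable where \<open>dup_num\<close> vanishes, since
  there \<open>dup s = 1\<close> is the singular end of the integral.
\<close>

lemma DERIV_arcsin_23_dup:
  assumes s: "0 < s" "s < 1" and nz: "dup_num (sqrt (1 - s ^ 3)) \<noteq> 0"
  shows "DERIV (\<lambda>s. arcsin_23 (dup s)) s :> sgn (dup_num (sqrt (1 - s ^ 3))) * (2 / sqrt (1 - s ^ 3))"
proof -
  define c where "c = sqrt (1 - s ^ 3)"
  have s3: "s ^ 3 < 1" using s by (simp add: power_less_one_iff)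
  have c: "0 < c" "c \<le> 1"
    using sqrt_one_minus_cube[of s] s s3 by (auto simp: c_def)
  have den: "dup_den c > 0" using dup_den_pos[of c] c by simp
  have root: "1 - dup s ^ 3 = (dup_num c / dup_den c) ^ 2"
    using dup_cube[of s] s by (simp add: c_def)
  have "dup s > 0"
    unfolding dup_def dup_coeff_def c_def[symmetric] using s c by simp
  moreover have "dup s \<noteq> 1"
  proof
    assume "dup s = 1"
    then show False using root nz den by (simp add: c_def)
  qed
  ultimately have "DERIV arcsin_23 (dup s) :> 1 / sqrt (1 - dup s ^ 3)"
    using dup_in_unit[of s] s by (intro DERIV_arcsin_23) auto
  also have "sqrt (1 - dup s ^ 3) = \<bar>dup_num c\<bar> / dup_den c"
    using den by (simp add: root abs_divide)
  finally have "DERIV (\<lambda>s. arcsin_23 (dup s)) s :>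
      1 / (\<bar>dup_num c\<bar> / dup_den c) * (2 * dup_num c / (dup_den c * c))"
    using DERIV_chain2[OF _ DERIV_dup[OF s, folded c_def]] by blast
  also have "1 / (\<bar>dup_num c\<bar> / dup_den c) * (2 * dup_num c / (dup_den c * c)) = sgn (dup_num c) * (2 / c)"
    using nz den c by (auto simp: sgn_if abs_if c_def[symmetric] field_simps)
  finally show ?thesis by (simp add: c_def)
qed

lemma continuous_on_arcsin_23_dup: "continuous_on {0..1} (\<lambda>s. arcsin_23 (dup s))"
  using dup_in_unit
  by (intro continuous_on_compose2[OF continuous_on_arcsin_pq continuous_on_dup]) auto

lemma dup_0 [simp]: "dup 0 = 0" and dup_1 [simp]: "dup 1 = 0"
  by (simp_all add: dup_def dup_coeff_def)

lemma dup_num_sqrt_less: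
  assumes "0 \<le> s" "s < t" "t \<le> 1"
  shows "dup_num (sqrt (1 - t ^ 3)) < dup_num (sqrt (1 - s ^ 3))"
  using assms power_strict_mono[of s t 3] power_le_one[of t 3]
  by (intro dup_num_strict_mono) auto

text \<open>
  Since \<open>dup_num\<close> decreases along \<open>s\<close>, nonnegativity at \<open>s\<close> forces positivity on \<open>[0, s)\<close>, and
  negativity propagates likewise to the right. So each of the next two identities compares two
  functions with equal derivatives on one interval, and the zero of \<open>dup_num\<close> never has to be located.
\<close>

lemma arcsin_23_dup_left:
  assumes s: "0 \<le> s" "s \<le> 1" and sign: "dup_num (sqrt (1 - s ^ 3)) \<ge> 0"
  shows "arcsin_23 (dup s) = 2 * arcsin_23 s"
proof (cases "s = 0")
  case False
  then have "0 < s" using s by simp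
  have "arcsin_23 (dup s) - 2 * arcsin_23 s = arcsin_23 (dup 0) - 2 * arcsin_23 0"
  proof (rule DERIV_isconst_end[OF \<open>0 < s\<close>])
    show "continuous_on {0..s} (\<lambda>s. arcsin_23 (dup s) - 2 * arcsin_23 s)"
      using s by (intro continuous_intros continuous_on_subset[OF continuous_on_arcsin_23_dup]
          continuous_on_subset[OF continuous_on_arcsin_pq]) auto
    fix t assume t: "0 < t" "t < s"
    then have "dup_num (sqrt (1 - t ^ 3)) > 0"
      using dup_num_sqrt_less[of t s] s sign by simp
    then show "DERIV (\<lambda>s. arcsin_23 (dup s) - 2 * arcsin_23 s) t :> 0"
      using DERIV_arcsin_23_dup[of t] DERIV_arcsin_23[of t] t s
      by (auto intro!: derivative_eq_intros)
  qed
  then show ?thesis by simp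
qed simp

lemma arcsin_23_dup_right:
  assumes s: "0 \<le> s" "s \<le> 1" and sign: "dup_num (sqrt (1 - s ^ 3)) \<le> 0"
  shows "arcsin_23 (dup s) = pi_pq 2 3 - 2 * arcsin_23 s"
proof (cases "s = 1")
  case False
  then have "s < 1" using s by simp
  have "arcsin_23 (dup 1) + 2 * arcsin_23 1 = arcsin_23 (dup s) + 2 * arcsin_23 s"
  proof (rule DERIV_isconst_end[OF \<open>s < 1\<close>])
    show "continuous_on {s..1} (\<lambda>s. arcsin_23 (dup s) + 2 * arcsin_23 s)"
      using s by (intro continuous_intros continuous_on_subset[OF continuous_on_arcsin_23_dup]
          continuous_on_subset[OF continuous_on_arcsin_pq]) auto
    fix t assume t: "s < t" "t < 1"
    then have "dup_num (sqrt (1 - t ^ 3)) < 0"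
      using dup_num_sqrt_less[of s t] s sign by simp
    then show "DERIV (\<lambda>s. arcsin_23 (dup s) + 2 * arcsin_23 s) t :> 0"
      using DERIV_arcsin_23_dup[of t] DERIV_arcsin_23[of t] t s
      by (auto intro!: derivative_eq_intros)
  qed
  then show ?thesis by (simp add: pi_pq_def)
qed (simp add: pi_pq_def)

lemma sin_pq_double:
  assumes "s \<in> {0..1}"
  shows "sin_pq 2 3 (2 * arcsin_23 s) = dup s"
proof (cases "dup_num (sqrt (1 - s ^ 3)) \<ge> 0")
  case True
  then show ?thesis
    using arcsin_23_dup_left[of s] sin_pq_arcsin_pq[of 2 3 "dup s"] dup_in_unit[of s] assms by simp
next
  case False
  then have "2 * arcsin_23 s = pi_pq 2 3 - arcsin_23 (dup s)"
    using arcsin_23_dup_right[of s] assms by simp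
  then show ?thesis
    using sin_pq_reflect[of 2 3 "dup s"] dup_in_unit[of s] assms by simp
qed

theorem theorem1p1:
  fixes x :: real
  assumes "x \<in> {0..pi_pq 2 3 / 2}"
  shows "sin_pq 2 3 (2 * x) =
    4 * sin_pq 2 3 x * cos_pq 2 3 x * (3 + cos_pq 2 3 x) ^ 3 /
      ((1 + cos_pq 2 3 x) * (8 + (sin_pq 2 3 x) ^ 3) ^ 2)"
proof -
  obtain s where s: "s \<in> {0..1}" "x = arcsin_23 s"
    using arcsin_pq_exhaust[of 2 3 x] assms by auto
  have sin: "sin_pq 2 3 x = s" "sin_pq 2 3 (2 * x) = dup s"
    using s sin_pq_arcsin_pq[of 2 3 s] sin_pq_double[of s] by auto
  show ?thesis
  (* The formula for the cosine covers 0 < s; at s = 0 both sides vanish with the sine. *)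
  proof (cases "s = 0")
    case True
    then show ?thesis by (simp add: sin)
  next
    case False
    define c where "c = sqrt (1 - s ^ 3)"
    have c: "0 \<le> c" "c \<le> 1" "s ^ 3 = 1 - c ^ 2"
      using sqrt_one_minus_cube[of s] s by (auto simp: c_def)
    have cos: "cos_pq 2 3 x = c"
      using cos_pq_arcsin_pq[of 2 3 s] s False power_le_one[of s 3]
      by (simp add: c_def powr_half_sqrt)
    have "8 + s ^ 3 = (3 + c) * (3 - c)"
      unfolding c(3) by algebra
    then have "4 * s * c * (3 + c) ^ 3 / ((1 + c) * (8 + s ^ 3) ^ 2)
        = ((3 + c) ^ 2 * (s * (4 * c * (3 + c)))) / ((3 + c) ^ 2 * ((1 + c) * (3 - c) ^ 2))"
      by (simp add: power_mult_distrib power2_eq_square power3_eq_cube mult_ac)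
    also have "\<dots> = s * (4 * c * (3 + c)) / ((1 + c) * (3 - c) ^ 2)"
      using c by (subst mult_divide_mult_cancel_left) auto
    also have "\<dots> = dup s"
      by (simp add: dup_def dup_coeff_def c_def)
    finally show ?thesis by (simp only: sin cos)
  qed
qed

end
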